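(* Let $G$ be a subgroup of $S_{\mathbb N}$. If $f\in\mathcal O_G(B_{c_0})$, then $$f(z'+z)=f(z)\quad\text{for all } z'\in B_{c_{0,\mathbb O_\infty}},\ z\in B_{c_0}\ \text{ such that } z'+z\in B_{c_0}.$$ Thus, the pullback map $\pi_{\mathbb O}^*$, $f\mapsto f\circ\pi_{\mathbb O}$, maps $\mathcal O_G(B_{c_{0,\mathbb O}})$ isomorphically onto $\mathcal O_G(B_{c_0})$.
   Context: $S_{\mathbb N}$ is the group of all permutations of $\mathbb N=\{1,2,\dots\}$. $c_0$ is the complex Banach space of sequences converging to $0$ with the supremum norm, $B_{c_0}$ its open unit ball, $\mathcal O(B_{c_0})$ the algebra of holomorphic (complex Fréchet differentiable) functions on $B_{c_0}$. For $\sigma\in S_{\mathbb N}$, $A_\sigma(z)=(z_{\sigma(1)},z_{\sigma(2)},\dots)$ for $z=(z_1,z_2,\dots)\in c_0$, and $A_\sigma^*(f)=f\circ A_\sigma$. $\mathcal O_G(B_{c_0})=\{f\in\mathcal O(B_{c_0}): A_\sigma^*(f)=f\ \text{for all }\sigma\in G\}$. $\mathbb O$ and $\mathbb O_\infty=\mathbb N\setminus\mathbb O$ are the unions of all finite and of all infinite orbits, respectively, of $G$ on $\mathbb N$. $c_{0,\mathbb O}=\{z\in c_0: z_n=0\ \forall n\in\mathbb O_\infty\}$ and $c_{0,\mathbb O_\infty}=\{z\in c_0: z_n=0\ \forall n\in\mathbb O\}$, so $c_0=c_{0,\mathbb O}\oplus c_{0,\mathbb O_\infty}$, both $A_\sigma$-invariant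 for $\sigma\in G$; $\pi_{\mathbb O}:c_0\to c_{0,\mathbb O}$ is the corresponding projection (it maps $B_{c_0}$ onto $B_{c_{0,\mathbb O}}$). $B_{c_{0,\mathbb O}}=B_{c_0}\cap c_{0,\mathbb O}$, $B_{c_{0,\mathbb O_\infty}}=B_{c_0}\cap c_{0,\mathbb O_\infty}$. $\mathcal O_G(B_{c_{0,\mathbb O}})$ is the algebra of holomorphic functions $f$ on $B_{c_{0,\mathbb O}}$ with $f\circ A_\sigma=f$ for all $\sigma\in G$. *)

theory Defs
  imports
    "HOL-Analysis.Analysis"
    "HOL-Algebra.Bij"
    "HOL-Algebra.Group_Action"
    "HOL-Algebra.Module"
    "HOL-Algebra.QuotRing"
begin

section \<open>The Banach space of complex null sequences\<close>

text \<open>Coordinates are indexed by the type \<^typ>\<open>nat\<close>, i.e. starting from 0 instead of 1.\<close>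

typedef c0 = "{x :: nat \<Rightarrow> complex. x \<longlonglongrightarrow> 0}"
  morphisms coord Abs_c0
  by (rule exI[of _ "\<lambda>_. 0"]) simp

setup_lifting type_definition_c0

lemma coord_tendsto: "coord x \<longlonglongrightarrow> 0"
  using coord by simp

lemma coord_Abs: "x \<longlonglongrightarrow> 0 \<Longrightarrow> coord (Abs_c0 x) = x"
  by (simp add: Abs_c0_inverse)

lemma c0_eqI: "(\<And>n. coord x n = coord y n) \<Longrightarrow> x = y"
  by (simp add: coord_inject[symmetric] fun_eq_iff)

lemma bdd_above_coord: "bdd_above (range (\<lambda>n. norm (coord x n)))"
proof -
  have "Bseq (coord x)"
    using coord_tendsto[of x] convergentI convergent_imp_Bseq by blast
  then show ?thesis
    by (auto simp: Bseq_def bdd_above_def)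
qed

instantiation c0 :: real_normed_vector
begin

lift_definition zero_c0 :: c0 is "\<lambda>_. 0" by simp
lift_definition plus_c0 :: "c0 \<Rightarrow> c0 \<Rightarrow> c0" is "\<lambda>x y n. x n + y n"
  using tendsto_add_zero by blast
lift_definition minus_c0 :: "c0 \<Rightarrow> c0 \<Rightarrow> c0" is "\<lambda>x y n. x n - y n"
  using tendsto_diff by fastforce
lift_definition uminus_c0 :: "c0 \<Rightarrow> c0" is "\<lambda>x n. - x n"
  using tendsto_minus by fastforce
lift_definition scaleR_c0 :: "real \<Rightarrow> c0 \<Rightarrow> c0" is "\<lambda>r x n. r *\<^sub>R x n"
  using tendsto_scaleR[OF tendsto_const] by fastforce

definition norm_c0 :: "c0 \<Rightarrow> real"
  where "norm_c0 x = (SUP n. norm (coord x n))"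
definition sgn_c0 :: "c0 \<Rightarrow> c0"
  where "sgn_c0 x = inverse (norm x) *\<^sub>R x"
definition dist_c0 :: "c0 \<Rightarrow> c0 \<Rightarrow> real"
  where "dist_c0 x y = norm (x - y)"
definition uniformity_c0 :: "(c0 \<times> c0) filter"
  where "uniformity_c0 = (INF e\<in>{0 <..}. principal {(x, y). dist x y < e})"
definition open_c0 :: "c0 set \<Rightarrow> bool"
  where "open_c0 S = (\<forall>x\<in>S. \<forall>\<^sub>F (x', y) in uniformity. x' = x \<longrightarrow> y \<in> S)"

lemma norm_coord_le: "norm (coord x n) \<le> norm x"
  unfolding norm_c0_def by (rule cSUP_upper[OF UNIV_I bdd_above_coord])

lemma norm_c0_le: "(\<And>n. norm (coord x n) \<le> b) \<Longrightarrow> norm x \<le> b"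
  unfolding norm_c0_def by (rule cSUP_least) auto

lemma norm_c0_scaleR_le: "norm (r *\<^sub>R x) \<le> \<bar>r\<bar> * norm (x :: c0)"
  by (rule norm_c0_le) (simp add: scaleR_c0.rep_eq mult_left_mono norm_coord_le)

instance
proof
  fix x y z :: c0 and a b r :: real
  show "x + y + z = x + (y + z)" "x + y = y + x" "0 + x = x" "- x + x = 0" "x - y = x + - y"
    by (transfer; simp add: algebra_simps)+
  show "a *\<^sub>R (x + y) = a *\<^sub>R x + a *\<^sub>R y" "(a + b) *\<^sub>R x = a *\<^sub>R x + b *\<^sub>R x"
    "a *\<^sub>R b *\<^sub>R x = (a * b) *\<^sub>R x" "1 *\<^sub>R x = x"
    by (transfer; simp add: algebra_simps)+
  show "norm x = 0 \<longleftrightarrow> x = 0"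
  proof
    assume "norm x = 0"
    then show "x = 0"
      using norm_coord_le[of x] by (intro c0_eqI) (simp add: zero_c0.rep_eq)
  next
    assume "x = 0"
    then show "norm x = 0"
      by (simp add: norm_c0_def zero_c0.rep_eq)
  qed
  show "norm (x + y) \<le> norm x + norm y"
  proof (rule norm_c0_le)
    fix n
    show "norm (coord (x + y) n) \<le> norm x + norm y"
      using norm_coord_le[of x n] norm_coord_le[of y n] norm_triangle_ineq[of "coord x n" "coord y n"]
      by (simp add: plus_c0.rep_eq)
  qed
  show "norm (r *\<^sub>R x) = \<bar>r\<bar> * norm x"
  proof (cases "r = 0")
    case True
    then have "r *\<^sub>R x = 0" by (intro c0_eqI) (simp add: scaleR_c0.rep_eq zero_c0.rep_eq)
    then show ?thesis using True by (simp add: norm_c0_def zero_c0.rep_eq)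
  next
    case False
    have "x = inverse r *\<^sub>R (r *\<^sub>R x)"
      using False by (intro c0_eqI) (simp add: scaleR_c0.rep_eq)
    then have "norm x \<le> \<bar>inverse r\<bar> * norm (r *\<^sub>R x)"
      using norm_c0_scaleR_le[of "inverse r" "r *\<^sub>R x"] by simp
    then have "\<bar>r\<bar> * norm x \<le> norm (r *\<^sub>R x)"
      using False by (simp add: field_simps abs_inverse)
    then show ?thesis using norm_c0_scaleR_le[of r x] by simp
  qed
qed (rule dist_c0_def sgn_c0_def uniformity_c0_def open_c0_def)+

end

lift_definition cscale :: "complex \<Rightarrow> c0 \<Rightarrow> c0" is "\<lambda>a x n. a * x n"
  by (rule tendsto_mult_right_zero)

section \<open>Permutations of coordinates and orbits\<close>

text \<open>For a permutation \<open>\<sigma>\<close> the permuted sequence is again a null sequence, see \<open>coord_perm\<close>;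
  for other \<open>\<sigma>\<close> the value of \<open>perm \<sigma>\<close> is irrelevant.\<close>

definition perm :: "(nat \<Rightarrow> nat) \<Rightarrow> c0 \<Rightarrow> c0"
  where "perm \<sigma> z = Abs_c0 (\<lambda>n. coord z (\<sigma> n))"

lemma coord_perm:
  assumes "bij \<sigma>"
  shows "coord (perm \<sigma> z) n = coord z (\<sigma> n)"
proof -
  have "finite (\<sigma> -` {k. \<not> P k})" if "finite {k. \<not> P k}" for P
    using that assms by (intro finite_vimageI) (auto simp: bij_is_inj)
  then have "filterlim \<sigma> sequentially sequentially"
    by (auto simp: filterlim_iff cofinite_eq_sequentially[symmetric] eventually_cofinite vimage_def)
  then have "(\<lambda>n. coord z (\<sigma> n)) \<longlonglongrightarrow> 0"
    by (rule filterlim_compose[OF coord_tendsto])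
  then show ?thesis
    by (simp add: perm_def coord_Abs)
qed

abbreviation sym_N :: "(nat \<Rightarrow> nat) monoid"
  where "sym_N \<equiv> BijGroup UNIV"

definition orbs :: "(nat \<Rightarrow> nat) set \<Rightarrow> nat set set"
  where "orbs G = orbits (sym_N\<lparr>carrier := G\<rparr>) UNIV (\<lambda>\<sigma>. \<sigma>)"

definition fin_part :: "(nat \<Rightarrow> nat) set \<Rightarrow> nat set"
  where "fin_part G = \<Union> {X \<in> orbs G. finite X}"

definition inf_part :: "(nat \<Rightarrow> nat) set \<Rightarrow> nat set"
  where "inf_part G = \<Union> {X \<in> orbs G. infinite X}"

definition c0_on :: "nat set \<Rightarrow> c0 set"
  where "c0_on A = {z. \<forall>n. n \<notin> A \<longrightarrow> coord z n = 0}"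

lift_definition proj :: "nat set \<Rightarrow> c0 \<Rightarrow> c0" is "\<lambda>A z n. if n \<in> A then z n else 0"
  by (rule Lim_null_comparison[OF _ tendsto_norm_zero]) auto

section \<open>Algebras of invariant holomorphic functions\<close>

definition unit_ball :: "c0 set \<Rightarrow> c0 set"
  where "unit_ball V = ball 0 1 \<inter> V"

text \<open>Complex Frechet differentiability on the open unit ball of a subspace \<open>V\<close>. The derivative is
  represented by a real-linear bounded map on the whole space that is complex homogeneous on \<open>V\<close>.
  For \<open>V = c0_on A\<close> this is no restriction on the derivative: a bounded complex-linear functional
  on \<open>V\<close> extends to the whole space by composing it with \<open>proj A\<close>.\<close>

definition holomorphic_ball :: "c0 set \<Rightarrow> (c0 \<Rightarrow> complex) \<Rightarrow> bool"
  where "holomorphic_ball V f \<longleftrightarrow>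
    (\<forall>z\<in>unit_ball V. \<exists>D. (f has_derivative D) (at z within unit_ball V) \<and>
      (\<forall>a. \<forall>h\<in>V. D (cscale a h) = a * D h))"

text \<open>Functions on the ball are represented extensionally, so that equality of functions
  is equality on the ball.\<close>

definition inv_hol :: "(nat \<Rightarrow> nat) set \<Rightarrow> c0 set \<Rightarrow> (c0 \<Rightarrow> complex) set"
  where "inv_hol G V = {f \<in> extensional (unit_ball V). holomorphic_ball V f \<and>
    (\<forall>\<sigma>\<in>G. \<forall>z\<in>unit_ball V. f (perm \<sigma> z) = f z)}"

definition inv_hol_algebra :: "(nat \<Rightarrow> nat) set \<Rightarrow> c0 set \<Rightarrow> (complex, c0 \<Rightarrow> complex) module"
  where "inv_hol_algebra G V =
    \<lparr>carrier = inv_hol G V,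
     mult = \<lambda>f g. \<lambda>z\<in>unit_ball V. f z * g z,
     one = \<lambda>z\<in>unit_ball V. 1,
     zero = \<lambda>z\<in>unit_ball V. 0,
     add = \<lambda>f g. \<lambda>z\<in>unit_ball V. f z + g z,
     smult = \<lambda>a f. \<lambda>z\<in>unit_ball V. a * f z\<rparr>"

definition algebra_iso ::
    "(complex, 'a) module \<Rightarrow> (complex, 'b) module \<Rightarrow> ('a \<Rightarrow> 'b) set"
  where "algebra_iso A B = {h \<in> ring_iso A B.
    \<forall>a. \<forall>f\<in>carrier A. h (a \<odot>\<^bsub>A\<^esub> f) = a \<odot>\<^bsub>B\<^esub> h f}"

definition pullback :: "nat set \<Rightarrow> (c0 \<Rightarrow> complex) \<Rightarrow> c0 \<Rightarrow> complex"
  where "pullback A f = restrict (f \<circ> proj A) (unit_ball UNIV)"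

end

theory Submission
  imports Defs "HOL-Complex_Analysis.Conformal_Mappings"
begin

text \<open>
  Let \<open>f\<close> be an invariant holomorphic function on the ball, let \<open>z\<close> be a finitely supported point
  living on the finite orbits and \<open>w\<close> one living on the infinite orbits. The claim is that
  \<open>f (z + w) = f z\<close>; the general case follows because finitely supported points are dense and
  \<open>f\<close> is continuous, and the statement about the pullback is then formal: \<open>f \<circ> proj (fin_part G) = f\<close>
  says that restriction to the ball of \<open>c0_on (fin_part G)\<close> is inverse to the pullback.

  There are two reasons why \<open>f\<close> cannot see \<open>w\<close>. The first is combinatorial. By B. H. Neumann's lemma
  a group is not a finite union of cosets of subgroups of infinite index; applied to
  point stabilisers this says that a finite subset of the infinite orbits can be moved off any given
  finite set (\<open>separation\<close>). Hence \<open>w\<close> has infinitely many translates \<open>w\<^sub>j = perm \<sigma>\<^sub>j w\<close> with pairwise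
  disjoint supports. As \<open>z\<close> has only finitely many translates, the \<open>\<sigma>\<^sub>j\<close> can be chosen to move \<open>z\<close> to
  one and the same point \<open>z\<^sub>1\<close>, and then invariance makes \<open>f (z\<^sub>1 + s w\<^sub>j) = f (z + s w)\<close> independent
  of \<open>j\<close>.

  The second is analytic, and it is where the supremum norm enters: a sum \<open>\<Sum>j<m. t\<^sub>j w\<^sub>j\<close> with
  \<open>\<bar>t\<^sub>j\<bar> \<le> 1\<close> is no longer than the longest \<open>w\<^sub>j\<close>, so for small \<open>s\<close> the function
  \<open>F(t) = f (z\<^sub>1 + \<Sum>j<m. 2 s t\<^sub>j w\<^sub>j)\<close> is bounded on the polydisc by a constant \<open>M\<close> that does not
  depend on \<open>m\<close>. The monomials being orthonormal on the torus, Bessel's inequality limits how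
  much \<open>F\<close> can vary along the \<open>m\<close> coordinate axes together. The version used here
  (\<open>Bessel_point_inequality\<close>) bounds \<open>\<Sum>j<m. \<bar>F (e\<^sub>j / 2) - F 0\<bar>\<^sup>2\<close> by \<open>2 M\<^sup>2\<close>. All \<open>m\<close> terms are
  equal and \<open>m\<close> is arbitrary, so they vanish: \<open>f (z + s w) = f z\<close> for all small \<open>s\<close>, and by the
  identity theorem for \<open>s = 1\<close>.
\<close>

section \<open>Mean values over the unit circle\<close>

definition circle_point :: "real \<Rightarrow> complex"
  where "circle_point x = exp (2 * of_real pi * \<i> * of_real x)"

lemma norm_circle_point [simp]: "norm (circle_point x) = 1"
  by (simp add: circle_point_def)

lemma Cauchy_circle_mean:
  assumes "h holomorphic_on cball 0 1" "norm a < 1"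
  shows "((\<lambda>x. h (circle_point x) * (circle_point x / (circle_point x - a))) has_integral h a) {0..1}"
proof -
  have "((\<lambda>u. h u / (u - a)) has_contour_integral (2 * of_real pi * \<i> * h a)) (circlepath 0 1)"
    using assms by (intro Cauchy_integral_circlepath_simple) auto
  then have "((\<lambda>x. h (circle_point x) / (circle_point x - a) * (2 * of_real pi * \<i> * circle_point x))
      has_integral 2 * of_real pi * \<i> * h a) {0..1}"
    unfolding has_contour_integral_def
    by (rule has_integral_eq[rotated], subst vector_derivative_circlepath01)
      (auto simp: circlepath circle_point_def mult_ac)
  from has_integral_mult_right[OF this, of "inverse (2 * of_real pi * \<i>)"]
  show ?thesis by (simp add: field_simps)
qed

lemma circle_mean_0:
  assumes "h holomorphic_on cball 0 1"
  shows "((\<lambda>x. h (circle_point x)) has_integral h 0) {0..1}"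
  using Cauchy_circle_mean[OF assms, of 0] by (simp add: circle_point_def)

lemma continuous_on_circle_point: "continuous_on S circle_point"
  unfolding circle_point_def by (intro continuous_intros)

lemma continuous_on_compose_circle_point:
  assumes "h holomorphic_on cball 0 1"
  shows "continuous_on {0..1} (\<lambda>x. h (circle_point x))"
  by (rule continuous_on_compose2[OF holomorphic_on_imp_continuous_on[OF assms] continuous_on_circle_point])
    auto

lemma integrable_norm_sq_circle:
  assumes "h holomorphic_on cball 0 1"
  shows "(\<lambda>x. (norm (h (circle_point x)))\<^sup>2) integrable_on {0..1}"
  by (intro integrable_continuous_interval continuous_intros
      continuous_on_compose_circle_point[OF assms])

text \<open>Cauchy's formula is applied to \<open>h\<^sup>2\<close> instead of \<open>h\<close>, so that the mean square appears at once; the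
  constant comes from \<open>\<bar>u - a\<bar> \<ge> 1 - \<bar>a\<bar>\<close> on the circle.\<close>

lemma norm_sq_le_circle_mean:
  assumes h: "h holomorphic_on cball 0 1" and a: "norm a < 1"
  shows "(1 - norm a) * (norm (h a))\<^sup>2 \<le> integral {0..1} (\<lambda>x. (norm (h (circle_point x)))\<^sup>2)"
proof -
  let ?K = "\<lambda>x. (h (circle_point x))\<^sup>2 * (circle_point x / (circle_point x - a))"
  have K: "(?K has_integral (h a)\<^sup>2) {0..1}"
    using Cauchy_circle_mean[OF holomorphic_on_power[OF h, of 2] a] by simp
  have le: "norm (?K x) \<le> (norm (h (circle_point x)))\<^sup>2 / (1 - norm a)" for x
  proof -
    have "1 - norm a \<le> norm (circle_point x - a)"
      using norm_triangle_ineq2[of "circle_point x" a] by simp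
    then show ?thesis
      using a by (simp add: norm_mult norm_divide norm_power frac_le)
  qed
  have "norm (integral {0..1} ?K) \<le> integral {0..1} (\<lambda>x. (norm (h (circle_point x)))\<^sup>2 / (1 - norm a))"
    using K le integrable_norm_sq_circle[OF h]
    by (intro integral_norm_bound_integral) (auto simp: has_integral_integrable_integral integrable_on_divide)
  then have "norm ((h a)\<^sup>2) \<le> integral {0..1} (\<lambda>x. (norm (h (circle_point x)))\<^sup>2) / (1 - norm a)"
    using K by (simp add: integral_unique)
  then show ?thesis
    using a by (simp add: field_simps norm_power)
qed

text \<open>Pythagoras: \<open>h - h 0\<close> has mean zero, so it is orthogonal to constants in \<open>L\<^sup>2\<close> of the circle.\<close>

lemma circle_mean_norm_sq:
  assumes h: "h holomorphic_on cball 0 1"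
  shows "integral {0..1} (\<lambda>x. (norm (h (circle_point x)))\<^sup>2) =
    (norm (h 0))\<^sup>2 + integral {0..1} (\<lambda>x. (norm (h (circle_point x) - h 0))\<^sup>2)"
proof -
  let ?d = "\<lambda>z. h z - h 0"
  have d: "?d holomorphic_on cball 0 1"
    using h by (intro holomorphic_intros)
  have "((\<lambda>x. ?d (circle_point x)) has_integral 0) {0..1}"
    using circle_mean_0[OF d] by simp
  from has_integral_linear[OF this bounded_linear_inner_right[of "h 0"]]
  have c: "((\<lambda>x. h 0 \<bullet> ?d (circle_point x)) has_integral 0) {0..1}"
    by (simp add: o_def)
  have n: "((\<lambda>x. (norm (?d (circle_point x)))\<^sup>2) has_integral
      integral {0..1} (\<lambda>x. (norm (?d (circle_point x)))\<^sup>2)) {0..1}"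
    using integrable_norm_sq_circle[OF d] by (rule integrable_integral)
  have k: "((\<lambda>x. (norm (h 0))\<^sup>2) has_integral (norm (h 0))\<^sup>2) {0..1::real}"
    using has_integral_const_real[of "(norm (h 0))\<^sup>2" 0 1] by simp
  have eq: "(norm (h z))\<^sup>2 = (norm (h 0))\<^sup>2 + (2 * (h 0 \<bullet> ?d z) + (norm (?d z))\<^sup>2)" for z
    by (simp add: power2_norm_eq_inner inner_diff_left inner_diff_right inner_commute)
  show ?thesis
    using has_integral_add[OF k has_integral_add[OF has_integral_mult_right[OF c, of 2] n]]
    by (intro integral_unique) (simp add: eq[symmetric])
qed

text \<open>By the two preceding facts the left-hand side is at most the circle mean of the right-hand side,
  and a continuous function attains a value at least as large as its mean. The gain over plain
  subharmonicity is the term with \<open>h0 a - h0 0\<close>, which measures how far \<open>h0\<close> is from a constant.\<close>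

lemma exists_large_point_on_circle:
  fixes h :: "'i \<Rightarrow> complex \<Rightarrow> complex"
  assumes h0: "h0 holomorphic_on cball 0 1"
    and h: "\<And>i. i \<in> I \<Longrightarrow> h i holomorphic_on cball 0 1"
    and a: "norm a < 1"
  obtains s where "norm s = 1"
    "(norm (h0 0))\<^sup>2 + (1 - norm a) * (norm (h0 a - h0 0))\<^sup>2 + (\<Sum>i\<in>I. (norm (h i 0))\<^sup>2)
      \<le> (norm (h0 s))\<^sup>2 + (\<Sum>i\<in>I. (norm (h i s))\<^sup>2)"
proof -
  define p where "p x = (norm (h0 (circle_point x)))\<^sup>2 + (\<Sum>i\<in>I. (norm (h i (circle_point x)))\<^sup>2)" for x
  define M where "M g = integral {0..1} (\<lambda>x. (norm (g (circle_point x)))\<^sup>2)" for g :: "complex \<Rightarrow> complex"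
  have "continuous_on {0..1} p"
    unfolding p_def by (intro continuous_intros continuous_on_compose_circle_point h0 h)
  then obtain x0 where x0: "\<And>x. x \<in> {0..1} \<Longrightarrow> p x \<le> p x0"
    using continuous_attains_sup[of "{0..1::real}" p] by (auto simp: Ball_def)
  have M: "((\<lambda>x. (norm (g (circle_point x)))\<^sup>2) has_integral M g) {0..1}"
    if "g holomorphic_on cball 0 1" for g
    unfolding M_def using integrable_norm_sq_circle[OF that] by (rule integrable_integral)
  have Mge: "(norm (g 0))\<^sup>2 \<le> M g" if "g holomorphic_on cball 0 1" for g
    using norm_sq_le_circle_mean[OF that, of 0] by (simp add: M_def)
  have "(norm (h0 0))\<^sup>2 + (1 - norm a) * (norm (h0 a - h0 0))\<^sup>2 \<le> M h0"
    unfolding M_def circle_mean_norm_sq[OF h0]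
    using norm_sq_le_circle_mean[OF holomorphic_on_diff[OF h0 holomorphic_on_const[of "h0 0"]] a]
    by simp
  moreover have "(\<Sum>i\<in>I. (norm (h i 0))\<^sup>2) \<le> (\<Sum>i\<in>I. M (h i))"
    by (intro sum_mono Mge h)
  moreover have "M h0 + (\<Sum>i\<in>I. M (h i)) \<le> p x0"
  proof -
    have "(p has_integral M h0 + (\<Sum>i\<in>I. M (h i))) {0..1}"
    proof (cases "finite I")
      case True
      then show ?thesis
        unfolding p_def by (intro has_integral_add has_integral_sum M h0 h)
    next
      case False
      then show ?thesis
        using M[OF h0] unfolding p_def by simp
    qed
    moreover have "((\<lambda>x. p x0) has_integral p x0) {0..1::real}"
      using has_integral_const_real[of "p x0" 0 1] by simp
    ultimately show ?thesis
      using x0 by (rule has_integral_le)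
  qed
  ultimately show ?thesis
    using that[of "circle_point x0"] by (simp add: p_def)
qed

text \<open>Replaces the multivariate Bessel inequality. Taylor coefficients along the axes are traded for the
  differences \<open>F (u(j := a)) - F u\<close>, which are visibly holomorphic in the other variables. The point
  \<open>v\<close> is built one coordinate at a time: at a suitable position of coordinate \<open>i\<close> on the circle, \<open>\<bar>F u\<bar>\<^sup>2\<close>
  together with the weighted sum over the indices still to be treated is at least as large as before,
  when the term with index \<open>i\<close> was still part of the sum. In this way no integral over a torus is
  needed.\<close>

lemma Bessel_point_inequality:
  fixes F :: "('i \<Rightarrow> complex) \<Rightarrow> complex"
  assumes "finite S" and a: "norm a < 1"
    and hol: "\<And>t i. \<forall>j. norm (t j) \<le> 1 \<Longrightarrow> (\<lambda>s. F (t(i := s))) holomorphic_on cball 0 1"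
    and u: "\<forall>j. norm (u j) \<le> 1" "\<And>j. j \<in> S \<Longrightarrow> u j = 0"
  shows "\<exists>v. (\<forall>j. norm (v j) \<le> 1) \<and>
    (norm (F u))\<^sup>2 + (1 - norm a) * (\<Sum>j\<in>S. (norm (F (u(j := a)) - F u))\<^sup>2) \<le> (norm (F v))\<^sup>2"
  using \<open>finite S\<close> u
proof (induction S arbitrary: u rule: finite_induct)
  case empty
  then show ?case by auto
next
  case (insert i S)
  define c where "c = sqrt (1 - norm a)"
  have c: "norm (of_real c * z :: complex) ^ 2 = (1 - norm a) * (norm z)\<^sup>2" for z
    using a by (simp add: c_def norm_mult power_mult_distrib)
  have ui: "u(i := 0) = u"
    using insert.prems(2)[of i] by auto
  define h where "h j s = of_real c * (F (u(i := s, j := a)) - F (u(i := s)))" for j s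
  have "(\<lambda>s. F (u(i := s))) holomorphic_on cball 0 1"
    using hol insert.prems(1) by blast
  moreover have "h j holomorphic_on cball 0 1" if "j \<in> S" for j
  proof -
    have "i \<noteq> j" using that insert.hyps by auto
    then have "(\<lambda>s. F (u(i := s, j := a))) holomorphic_on cball 0 1"
      using hol[of "u(j := a)" i] insert.prems(1) a by (simp add: fun_upd_twist)
    then show ?thesis
      unfolding h_def using hol insert.prems(1) by (intro holomorphic_intros) blast+
  qed
  ultimately obtain s where s: "norm s = 1" and
    le: "(norm (F u))\<^sup>2 + (1 - norm a) * (norm (F (u(i := a)) - F u))\<^sup>2 + (\<Sum>j\<in>S. (norm (h j 0))\<^sup>2)
      \<le> (norm (F (u(i := s))))\<^sup>2 + (\<Sum>j\<in>S. (norm (h j s))\<^sup>2)"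
    using a exists_large_point_on_circle[of "\<lambda>s. F (u(i := s))" S h a] ui by auto
  have us: "\<forall>j. norm ((u(i := s)) j) \<le> 1" "\<And>j. j \<in> S \<Longrightarrow> (u(i := s)) j = 0"
    using insert.prems insert.hyps s by auto
  obtain v where v: "\<forall>j. norm (v j) \<le> 1" and "(norm (F (u(i := s))))\<^sup>2 +
      (1 - norm a) * (\<Sum>j\<in>S. (norm (F (u(i := s, j := a)) - F (u(i := s))))\<^sup>2) \<le> (norm (F v))\<^sup>2"
    using insert.IH[OF us] by blast
  moreover have "(1 - norm a) * (\<Sum>j\<in>insert i S. (norm (F (u(j := a)) - F u))\<^sup>2)
      = (1 - norm a) * (norm (F (u(i := a)) - F u))\<^sup>2 + (\<Sum>j\<in>S. (norm (h j 0))\<^sup>2)"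
    using insert.hyps by (simp add: h_def c ui sum_distrib_left distrib_left)
  moreover have "(1 - norm a) * (\<Sum>j\<in>S. (norm (F (u(i := s, j := a)) - F (u(i := s))))\<^sup>2)
      = (\<Sum>j\<in>S. (norm (h j s))\<^sup>2)"
    by (simp add: h_def c sum_distrib_left)
  ultimately have "(norm (F u))\<^sup>2 +
      (1 - norm a) * (\<Sum>j\<in>insert i S. (norm (F (u(j := a)) - F u))\<^sup>2) \<le> (norm (F v))\<^sup>2"
    using le by linarith
  with v show ?case by blast
qed

section \<open>Linear structure of the space of null sequences\<close>

lemmas coord_simps = zero_c0.rep_eq plus_c0.rep_eq minus_c0.rep_eq uminus_c0.rep_eq
  scaleR_c0.rep_eq cscale.rep_eq proj.rep_eq

lemma coord_sum: "coord (\<Sum>i\<in>I. x i) n = (\<Sum>i\<in>I. coord (x i) n)"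
  by (induction I rule: infinite_finite_induct) (auto simp: coord_simps)

lemma norm_cscale: "norm (cscale a z) = norm a * norm z"
proof -
  have le: "norm (cscale b x) \<le> norm b * norm x" for b x
    by (rule norm_c0_le) (simp add: coord_simps norm_mult mult_left_mono norm_coord_le)
  show ?thesis
  proof (cases "a = 0")
    case True
    then show ?thesis using le[of a z] by simp
  next
    case False
    then have "z = cscale (inverse a) (cscale a z)"
      by (intro c0_eqI) (simp add: coord_simps)
    then have "norm z \<le> norm (inverse a) * norm (cscale a z)"
      using le[of "inverse a" "cscale a z"] by simp
    then have "norm a * norm z \<le> norm (cscale a z)"
      using False by (simp add: norm_inverse norm_divide field_simps)
    then show ?thesis using le[of a z] by simp
  qed
qed

lemma sum_cscale_fun_upd:
  assumes "finite I" "i \<in> I"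
  shows "(\<Sum>j\<in>I. cscale ((t(i := r)) j) (w j)) =
    (\<Sum>j\<in>I - {i}. cscale (t j) (w j)) + cscale r (w i)"
proof -
  have "(\<Sum>j\<in>I - {i}. cscale ((t(i := r)) j) (w j)) = (\<Sum>j\<in>I - {i}. cscale (t j) (w j))"
    by (rule sum.cong) auto
  then show ?thesis
    unfolding sum.remove[OF assms] by (simp add: add.commute)
qed

lemma bounded_linear_cscale_left: "bounded_linear (\<lambda>s. cscale s v)"
  by (rule bounded_linear_intro[of _ "norm v"])
    (auto intro!: c0_eqI simp: coord_simps norm_cscale algebra_simps)

lemma norm_proj_le: "norm (proj A z) \<le> norm z"
proof (rule norm_c0_le)
  show "norm (coord (proj A z) n) \<le> norm z" for n
    using norm_coord_le[of z n] by (auto simp: coord_simps)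
qed

lemma bounded_linear_proj: "bounded_linear (proj A)"
  by (rule bounded_linear_intro[of _ 1])
    (auto intro!: c0_eqI simp: coord_simps norm_proj_le)

lemma proj_cscale: "proj A (cscale a z) = cscale a (proj A z)"
  by (rule c0_eqI) (simp add: coord_simps)

lemma proj_in_c0_on: "proj A z \<in> c0_on A"
  by (simp add: c0_on_def coord_simps)

lemma proj_id: "z \<in> c0_on A \<Longrightarrow> proj A z = z"
  by (rule c0_eqI) (auto simp: c0_on_def coord_simps)

lemma proj_in_unit_ball: "z \<in> unit_ball UNIV \<Longrightarrow> proj A z \<in> unit_ball (c0_on A)"
  using norm_proj_le[of A z] by (simp add: unit_ball_def proj_in_c0_on)

lemma norm_perm_le: "bij \<sigma> \<Longrightarrow> norm (perm \<sigma> z) \<le> norm z"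
  by (rule norm_c0_le) (simp add: coord_perm norm_coord_le)

lemma perm_add_cscale:
  "bij \<sigma> \<Longrightarrow> perm \<sigma> (z + cscale s w) = perm \<sigma> z + cscale s (perm \<sigma> w)"
  by (rule c0_eqI) (simp add: coord_perm coord_simps)

lemma proj_truncation_tendsto: "(\<lambda>N. proj {..<N} z) \<longlonglongrightarrow> z"
proof (rule LIMSEQ_I)
  fix e :: real assume "0 < e"
  then obtain N where N: "\<And>n. n \<ge> N \<Longrightarrow> norm (coord z n) < e / 2"
    using LIMSEQ_D[OF coord_tendsto[of z], of "e / 2"] by auto
  have "norm (proj {..<M} z - z) < e" if "M \<ge> N" for M
  proof -
    have "norm (proj {..<M} z - z) \<le> e / 2"
      using N that \<open>0 < e\<close> by (intro norm_c0_le) (auto simp: coord_simps intro: less_imp_le)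
    then show ?thesis using \<open>0 < e\<close> by simp
  qed
  then show "\<exists>N. \<forall>M\<ge>N. norm (proj {..<M} z - z) < e" by blast
qed

lemma norm_disjoint_sum_less_1:
  assumes "norm x < 1" "norm y < 1" "\<And>n. coord x n = 0 \<or> coord y n = 0"
  shows "norm (x + y :: c0) < 1"
proof -
  have "norm (coord (x + y) n) \<le> max (norm x) (norm y)" for n
    using assms(3)[of n] norm_coord_le[of x n] norm_coord_le[of y n]
    by (auto simp: coord_simps max_def)
  then have "norm (x + y) \<le> max (norm x) (norm y)"
    by (rule norm_c0_le)
  then show ?thesis using assms by simp
qed

text \<open>This bound, uniform in the number of summands, is what distinguishes the supremum norm from the
  \<open>l\<^sup>p\<close> norms with finite \<open>p\<close>, which admit nonconstant symmetric polynomials: \<open>\<Sum>n. z\<^sub>n ^ k\<close> for \<open>k \<ge> p\<close>.\<close>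

lemma norm_disjoint_combination_le:
  fixes w :: "'i \<Rightarrow> c0"
  assumes "finite I" "\<And>i. i \<in> I \<Longrightarrow> norm (w i) \<le> r" "\<And>i. i \<in> I \<Longrightarrow> norm (t i) \<le> 1" "0 \<le> r"
    and disj: "\<And>i j n. i \<in> I \<Longrightarrow> j \<in> I \<Longrightarrow> i \<noteq> j \<Longrightarrow> coord (w i) n = 0 \<or> coord (w j) n = 0"
  shows "norm (\<Sum>i\<in>I. cscale (t i) (w i)) \<le> r"
proof (rule norm_c0_le)
  fix n
  show "norm (coord (\<Sum>i\<in>I. cscale (t i) (w i)) n) \<le> r"
  proof (cases "\<exists>i\<in>I. coord (w i) n \<noteq> 0")
    case True
    then obtain i where i: "i \<in> I" "coord (w i) n \<noteq> 0" by blast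
    then have z: "coord (w j) n = 0" if "j \<in> I - {i}" for j
      using disj[of i j n] that by auto
    have "coord (\<Sum>i\<in>I. cscale (t i) (w i)) n = t i * coord (w i) n"
      using i z \<open>finite I\<close> by (simp add: coord_sum coord_simps sum.remove[of I i])
    also have "norm \<dots> \<le> 1 * r"
      unfolding norm_mult using assms i norm_coord_le[of "w i" n]
      by (intro mult_mono) (auto intro: order_trans)
    finally show ?thesis by simp
  next
    case False
    then show ?thesis using \<open>0 \<le> r\<close> by (simp add: coord_sum coord_simps)
  qed
qed

section \<open>Holomorphic functions along disjointly supported directions\<close>

lemma holomorphic_ball_line:
  assumes f: "holomorphic_ball UNIV f" and U: "\<And>s. s \<in> U \<Longrightarrow> norm (z + cscale s v) < 1"
  shows "(\<lambda>s. f (z + cscale s v)) holomorphic_on U"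
  unfolding holomorphic_on_def
proof
  fix s assume "s \<in> U"
  let ?l = "\<lambda>s. z + cscale s v"
  have "norm (z + cscale s v) < 1" by (rule U[OF \<open>s \<in> U\<close>])
  then have "?l s \<in> unit_ball UNIV" by (simp add: unit_ball_def)
  then obtain D where D: "(f has_derivative D) (at (?l s) within unit_ball UNIV)"
    and hom: "\<And>a h. D (cscale a h) = a * D h"
    using f unfolding holomorphic_ball_def by blast
  have "(?l has_derivative (\<lambda>s. cscale s v)) (at s within U)"
    using bounded_linear_imp_has_derivative[OF bounded_linear_cscale_left]
    by (auto intro!: derivative_eq_intros)
  moreover have "?l ` U \<subseteq> unit_ball UNIV"
    using U by (auto simp: unit_ball_def)
  ultimately have "((f \<circ> ?l) has_derivative (D \<circ> (\<lambda>s. cscale s v))) (at s within U)"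
    by (intro diff_chain_within has_derivative_subset[OF D])
  then have "((\<lambda>s. f (?l s)) has_derivative (\<lambda>h. D v * h)) (at s within U)"
    by (simp add: o_def hom mult.commute)
  then show "(\<lambda>s. f (?l s)) field_differentiable at s within U"
    by (auto simp: field_differentiable_def has_field_derivative_def)
qed

lemma holomorphic_ball_continuous:
  assumes "holomorphic_ball UNIV f"
  shows "continuous_on (unit_ball UNIV) f"
  using assms unfolding holomorphic_ball_def continuous_on_eq_continuous_within
  by (blast intro: has_derivative_continuous)

text \<open>A holomorphic function that looks the same along infinitely many disjointly supported directions is
  constant near the base point along each of them: on a neighbourhood where \<open>f\<close> is bounded, the Bessel-type inequality
  for \<open>m\<close> of the directions gives \<open>m / 2 * \<bar>g s - f z\<bar>\<^sup>2 \<le> M\<^sup>2\<close>.\<close>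

lemma constant_along_disjoint_copies:
  fixes w :: "nat \<Rightarrow> c0"
  assumes f: "holomorphic_ball UNIV f" and z: "norm z < 1"
    and w: "\<And>j. norm (w j) < 1"
    and disj: "\<And>i j n. i \<noteq> j \<Longrightarrow> coord (w i) n = 0 \<or> coord (w j) n = 0"
    and g: "\<And>j s. norm s \<le> 1 \<Longrightarrow> f (z + cscale s (w j)) = g s"
  shows "\<exists>e>0. \<forall>s. norm s < e \<longrightarrow> g s = f z"
proof -
  have "isCont f z"
    using holomorphic_ball_continuous[OF f] z
    by (auto simp: unit_ball_def continuous_on_eq_continuous_at)
  then obtain d where d: "d > 0" "\<And>x. norm (x - z) < d \<Longrightarrow> norm (f x - f z) < 1"
    unfolding continuous_at_eps_delta dist_norm by (metis zero_less_one)
  \<comment> \<open>The polydisc below is mapped into the ball of radius \<open>2 e\<close> around \<open>z\<close>, which has to lie in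
    the unit ball and in the neighbourhood where \<open>f\<close> is bounded.\<close>
  define e where "e = min (min (d / 4) (1/2)) ((1 - norm z) / 4)"
  have e: "e > 0" "2 * e \<le> 1" "2 * e < d" "2 * e < 1 - norm z"
    using d(1) z by (auto simp: e_def min_def)
  have "g s = f z" if s: "norm s < e" for s
  proof (rule ccontr)
    assume ne: "g s \<noteq> f z"
    define M where "M = norm (f z) + 1"
    obtain m :: nat where m: "M\<^sup>2 < real m * (1/2 * (norm (g s - f z))\<^sup>2)"
      using ne reals_Archimedean3[of "1/2 * (norm (g s - f z))\<^sup>2"] by auto
    \<comment> \<open>The factor 2 makes the polydisc point \<open>1/2\<close> on the \<open>j\<close>-th axis correspond to \<open>z + s w\<^sub>j\<close>.\<close>
    define x where "x t = z + (\<Sum>j<m. cscale (t j) (cscale (2 * s) (w j)))" for t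
    define F where "F t = f (x t)" for t
    have disj': "coord (cscale (2 * s) (w i)) n = 0 \<or> coord (cscale (2 * s) (w j)) n = 0"
      if "i \<noteq> j" for i j n
      using disj[OF that, of n] by (auto simp: cscale.rep_eq)
    have x: "norm (x t - z) \<le> 2 * e" if "\<forall>j. norm (t j) \<le> 1" for t
    proof -
      have "norm (cscale (2 * s) (w j)) \<le> 2 * e" for j
        unfolding norm_cscale using s w[of j] e(1) mult_mono[of "norm (2 * s)" "2 * e" "norm (w j)" 1]
        by (simp add: norm_mult less_imp_le)
      then have "norm (\<Sum>j<m. cscale (t j) (cscale (2 * s) (w j))) \<le> 2 * e"
        using that e(1) by (intro norm_disjoint_combination_le disj') auto
      then show ?thesis by (simp add: x_def)
    qed
    have ball: "norm (x t) < 1" if "\<forall>j. norm (t j) \<le> 1" for t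
      using x[OF that] e norm_triangle_ineq[of "x t - z" z] by simp
    have hol: "(\<lambda>r. F (t(i := r))) holomorphic_on cball 0 1" if t: "\<forall>j. norm (t j) \<le> 1" for t i
    proof (cases "i < m")
      case True
      define y where "y = z + (\<Sum>j\<in>{..<m} - {i}. cscale (t j) (cscale (2 * s) (w j)))"
      have split: "x (t(i := r)) = y + cscale r (cscale (2 * s) (w i))" for r
        using True unfolding x_def y_def by (subst sum_cscale_fun_upd) (auto simp: add.assoc)
      have "norm (y + cscale r (cscale (2 * s) (w i))) < 1" if "r \<in> cball 0 1" for r
        using ball[of "t(i := r)"] t that by (simp add: split)
      then show ?thesis
        unfolding F_def split by (rule holomorphic_ball_line[OF f])
    next
      case False
      then have "x (t(i := r)) = x t" for r
        unfolding x_def by (intro arg_cong2[where f = "(+)"] refl sum.cong) auto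
      then show ?thesis by (simp add: F_def)
    qed
    obtain v where v: "\<forall>j. norm (v j) \<le> 1" and
      le: "(norm (F (\<lambda>_. 0)))\<^sup>2 + (1 - norm (1/2 :: complex)) *
        (\<Sum>j<m. (norm (F ((\<lambda>_. 0)(j := 1/2)) - F (\<lambda>_. 0)))\<^sup>2) \<le> (norm (F v))\<^sup>2"
      using Bessel_point_inequality[of "{..<m}" "1/2" F "\<lambda>_. 0"] hol by auto
    have "F (\<lambda>_. 0) = f z"
      unfolding F_def x_def by (intro arg_cong[of _ _ f] c0_eqI) (simp add: coord_simps coord_sum)
    moreover have "F ((\<lambda>_. 0)(j := 1/2)) = g s" if "j < m" for j
    proof -
      have "x ((\<lambda>_. 0)(j := 1/2)) = z + cscale s (w j)"
        unfolding x_def using that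
        by (subst sum_cscale_fun_upd) (auto intro!: c0_eqI simp: coord_simps coord_sum)
      then show ?thesis
        using g[of s j] s e by (simp add: F_def)
    qed
    ultimately have "(norm (f z))\<^sup>2 + real m * (1/2 * (norm (g s - f z))\<^sup>2) \<le> (norm (F v))\<^sup>2"
      using le by (simp add: norm_divide)
    also have "norm (F v) \<le> M"
      using d(2)[of "x v"] x[OF v] e norm_triangle_ineq[of "f (x v) - f z" "f z"]
      by (simp add: F_def M_def)
    then have "(norm (F v))\<^sup>2 \<le> M\<^sup>2" by (simp add: power_mono)
    finally show False using m zero_le_power2[of "norm (f z)"] by linarith
  qed
  with e(1) show ?thesis by blast
qed

section \<open>Permutation groups and Neumann's separation lemma\<close>

lemma mem_orbs_iff: "X \<in> orbs G \<longleftrightarrow> (\<exists>n. X = (\<lambda>\<sigma>. \<sigma> n) ` G)"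
  by (auto simp: orbs_def orbits_def orbit_def image_def)

locale permutation_subgroup =
  fixes G :: "(nat \<Rightarrow> nat) set"
  assumes subgroup: "subgroup G sym_N"
begin

lemma bij: "\<sigma> \<in> G \<Longrightarrow> bij \<sigma>"
  using subgroup.subset[OF subgroup] by (auto simp: BijGroup_def Bij_def)

lemma id_mem: "id \<in> G"
  using subgroup.one_closed[OF subgroup] by (simp add: BijGroup_def restrict_UNIV id_def)

lemma comp_mem:
  assumes "\<sigma> \<in> G" "\<tau> \<in> G"
  shows "\<sigma> \<circ> \<tau> \<in> G"
  using subgroup.m_closed[OF subgroup assms] bij[OF assms(1)] bij[OF assms(2)]
  by (simp add: BijGroup_def Bij_def compose_def restrict_UNIV o_def)

lemma inv_mem:
  assumes "\<sigma> \<in> G"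
  shows "inv_into UNIV \<sigma> \<in> G"
proof -
  interpret S: group sym_N by (rule group_BijGroup)
  have "inv\<^bsub>sym_N\<^esub> \<sigma> \<in> G"
    using subgroup.m_inv_closed[OF subgroup assms] .
  moreover have "inv\<^bsub>sym_N\<^esub> \<sigma> = inv_into UNIV \<sigma>"
  proof (rule S.inv_equality)
    have b: "bij \<sigma>" "bij (inv_into UNIV \<sigma>)" using bij[OF assms] by (auto simp: bij_imp_bij_inv)
    then show "inv_into UNIV \<sigma> \<otimes>\<^bsub>sym_N\<^esub> \<sigma> = \<one>\<^bsub>sym_N\<^esub>"
      by (simp add: BijGroup_def Bij_def compose_def bij_is_inj fun_eq_iff)
    show "\<sigma> \<in> carrier sym_N" "inv_into UNIV \<sigma> \<in> carrier sym_N"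
      using b by (auto simp: BijGroup_def Bij_def)
  qed
  ultimately show ?thesis by simp
qed

definition orbit_of :: "nat \<Rightarrow> nat set"
  where "orbit_of n = (\<lambda>\<sigma>. \<sigma> n) ` G"

lemma orbit_of_perm:
  assumes "\<sigma> \<in> G"
  shows "orbit_of (\<sigma> n) = orbit_of n"
proof
  show "orbit_of (\<sigma> n) \<subseteq> orbit_of n"
  proof
    fix k assume "k \<in> orbit_of (\<sigma> n)"
    then obtain \<tau> where "\<tau> \<in> G" "k = (\<tau> \<circ> \<sigma>) n" by (auto simp: orbit_of_def)
    then show "k \<in> orbit_of n" using comp_mem[OF _ assms] unfolding orbit_of_def by blast
  qed
  show "orbit_of n \<subseteq> orbit_of (\<sigma> n)"
  proof
    fix k assume "k \<in> orbit_of n"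
    then obtain \<tau> where "\<tau> \<in> G" "k = \<tau> n" by (auto simp: orbit_of_def)
    then have "\<tau> \<circ> inv_into UNIV \<sigma> \<in> G" "k = (\<tau> \<circ> inv_into UNIV \<sigma>) (\<sigma> n)"
      using comp_mem inv_mem[OF assms] bij[OF assms] by (auto simp: bij_is_inj)
    then show "k \<in> orbit_of (\<sigma> n)" unfolding orbit_of_def by blast
  qed
qed

lemma self_mem_orbit_of: "n \<in> orbit_of n"
  using imageI[OF id_mem, of "\<lambda>\<sigma>. \<sigma> n"] by (simp add: orbit_of_def)

lemma orbs_eq: "orbs G = range orbit_of"
  by (force simp: mem_orbs_iff orbit_of_def[abs_def])

lemma mem_orbit_of_iff: "k \<in> orbit_of n \<longleftrightarrow> orbit_of k = orbit_of n"
  using orbit_of_perm self_mem_orbit_of by (auto simp: orbit_of_def[of n])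

lemma fin_part_iff: "n \<in> fin_part G \<longleftrightarrow> finite (orbit_of n)"
  using self_mem_orbit_of by (auto simp: fin_part_def orbs_eq mem_orbit_of_iff)

lemma inf_part_iff: "n \<in> inf_part G \<longleftrightarrow> infinite (orbit_of n)"
  using self_mem_orbit_of by (auto simp: inf_part_def orbs_eq mem_orbit_of_iff)

lemma perm_fin_part_iff: "\<sigma> \<in> G \<Longrightarrow> \<sigma> n \<in> fin_part G \<longleftrightarrow> n \<in> fin_part G"
  by (simp add: fin_part_iff orbit_of_perm)

text \<open>Neumann's lemma for point stabilisers. A pair \<open>(a, b)\<close> stands for the coset
  \<open>{\<sigma>\<in>G. \<sigma> a = b}\<close> of the stabiliser of \<open>a\<close>. Suppose finitely many of them cover \<open>G\<close>. Since the
  orbit of \<open>p\<close> is infinite, some coset \<open>{\<sigma>\<in>G. \<sigma> p = y p}\<close> is not in the list, hence is covered by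
  cosets of the stabilisers of the other points. Its left translates, which are all the cosets of the
  stabiliser of \<open>p\<close>, are then covered by translates of these, so \<open>p\<close> can be eliminated.\<close>

lemma not_covered_by_point_cosets:
  assumes "finite F" "\<And>a. a \<in> F \<Longrightarrow> infinite (orbit_of a)" "finite K" "fst ` K \<subseteq> F"
  shows "\<exists>\<sigma>\<in>G. \<forall>(a, b)\<in>K. \<sigma> a \<noteq> b"
  using assms
proof (induction F arbitrary: K rule: finite_induct)
  case empty
  then show ?case using id_mem by auto
next
  case (insert p F)
  show ?case
  proof (rule ccontr)
    assume "\<not> ?case"
    then have cover: "\<exists>(a, b)\<in>K. \<sigma> a = b" if "\<sigma> \<in> G" for \<sigma>
      using that by fastforce
    have "\<not> orbit_of p \<subseteq> snd ` K"
      using insert.prems by (meson finite_imageI finite_subset insertI1)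
    then obtain y where y: "y \<in> G" "y p \<notin> snd ` K"
      by (auto simp: orbit_of_def)
    define L where "L = {(a, c) \<in> K. a \<noteq> p}"
    define B where "B = snd ` K \<inter> orbit_of p"
    have "\<exists>x. \<forall>b\<in>B. x b \<in> G \<and> x b p = b"
      by (rule bchoice) (auto simp: B_def orbit_of_def)
    then obtain x where x: "\<And>b. b \<in> B \<Longrightarrow> x b \<in> G" "\<And>b. b \<in> B \<Longrightarrow> x b p = b"
      by blast
    \<comment> \<open>Multiplication by \<open>x b \<circ> inv y\<close> carries the coset missing from \<open>K\<close> to \<open>{\<sigma>\<in>G. \<sigma> p = b}\<close>.\<close>
    define K' where "K' = L \<union> (\<Union>b\<in>B. (\<lambda>(a, c). (a, x b (inv_into UNIV y c))) ` L)"
    have "L \<subseteq> K" by (auto simp: L_def)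
    then have "finite L" using insert.prems(2) by (rule finite_subset)
    then have "finite K'" "fst ` K' \<subseteq> F"
      using insert.prems(2,3) by (auto simp: K'_def L_def B_def)
    then obtain \<sigma> where \<sigma>: "\<sigma> \<in> G" "\<And>a b. (a, b) \<in> K' \<Longrightarrow> \<sigma> a \<noteq> b"
      using insert.IH[of K'] insert.prems(1) by blast
    obtain a b where ab: "(a, b) \<in> K" "\<sigma> a = b"
      using cover[OF \<sigma>(1)] by auto
    then have "a = p"
      using \<sigma>(2) by (auto simp: K'_def L_def)
    then have b: "b \<in> B"
      using ab \<sigma>(1) by (force simp: B_def orbit_of_def)
    let ?\<rho> = "y \<circ> (inv_into UNIV (x b) \<circ> \<sigma>)"
    have "?\<rho> \<in> G"
      using comp_mem inv_mem x(1)[OF b] y(1) \<sigma>(1) by blast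
    then obtain a' c where ac: "(a', c) \<in> K" "?\<rho> a' = c"
      using cover[of ?\<rho>] by blast
    have "?\<rho> p = y p"
      using ab \<open>a = p\<close> x[OF b] bij[OF x(1)[OF b]] by (metis bij_inv_eq_iff comp_apply)
    then have "a' \<noteq> p"
      using ac y(2) by force
    then have "(a', x b (inv_into UNIV y c)) \<in> K'"
      using ac b by (force simp: K'_def L_def)
    moreover have "\<sigma> a' = x b (inv_into UNIV y c)"
      using ac(2) bij[OF y(1)] bij[OF x(1)[OF b]] by (metis bij_inv_eq_iff comp_apply)
    ultimately show False using \<sigma>(2) by blast
  qed
qed

text \<open>The preceding lemma provides \<open>\<tau>\<close> with \<open>\<tau> ` F \<inter> E = {}\<close>. The conclusion is about preimages, that is,
  about the inverse of \<open>\<tau>\<close>, because \<open>perm \<sigma>\<close> moves supports by preimages under \<open>\<sigma>\<close>.\<close>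

lemma separation:
  assumes "finite F" "F \<subseteq> inf_part G" "finite E"
  shows "\<exists>\<sigma>\<in>G. \<forall>a. \<sigma> a \<in> F \<longrightarrow> a \<notin> E"
proof -
  have "\<exists>\<tau>\<in>G. \<forall>(a, b)\<in>F \<times> E. \<tau> a \<noteq> b"
    using assms by (intro not_covered_by_point_cosets[of F]) (auto simp: inf_part_iff)
  then obtain \<tau> where \<tau>: "\<tau> \<in> G" "\<And>a b. a \<in> F \<Longrightarrow> b \<in> E \<Longrightarrow> \<tau> a \<noteq> b"
    by blast
  have "a \<notin> E" if "inv_into UNIV \<tau> a \<in> F" for a
    using \<tau>(2)[OF that, of a] bij[OF \<tau>(1)] by (auto simp: bij_is_surj surj_f_inv_f)
  then show ?thesis using inv_mem[OF \<tau>(1)] by blast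
qed

lemma disjoint_translates:
  assumes "finite F" "F \<subseteq> inf_part G"
  obtains \<sigma> :: "nat \<Rightarrow> nat \<Rightarrow> nat" where "\<And>j. \<sigma> j \<in> G"
    "\<And>i j a. i \<noteq> j \<Longrightarrow> \<not> (\<sigma> i a \<in> F \<and> \<sigma> j a \<in> F)"
proof -
  define P where "P \<sigma> j \<tau> \<longleftrightarrow> \<tau> \<in> G \<and> (\<forall>i<j. \<forall>a. \<not> (\<sigma> i a \<in> F \<and> \<tau> a \<in> F))"
    for \<sigma> :: "nat \<Rightarrow> nat \<Rightarrow> nat" and j \<tau>
  have "\<exists>\<sigma>. \<forall>j. P \<sigma> j (\<sigma> j)"
  proof (rule dependent_wellorder_choice)
    fix j and \<sigma> :: "nat \<Rightarrow> nat \<Rightarrow> nat"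
    assume IH: "\<And>i. i < j \<Longrightarrow> P \<sigma> i (\<sigma> i)"
    have "finite (\<Union>i<j. \<sigma> i -` F)"
    proof (intro finite_UN_I finite_vimageI \<open>finite F\<close>)
      fix i assume "i \<in> {..<j}"
      then show "inj (\<sigma> i)" using IH[of i] bij by (auto simp: P_def bij_is_inj)
    qed simp
    from separation[OF assms this] show "\<exists>\<tau>. P \<sigma> j \<tau>"
      unfolding P_def by blast
  qed (simp add: P_def)
  then obtain \<sigma> where \<sigma>: "\<And>j :: nat. \<sigma> j \<in> G"
    "\<And>i j a. i < j \<Longrightarrow> \<not> (\<sigma> i a \<in> F \<and> \<sigma> j a \<in> F)"
    unfolding P_def by blast
  show ?thesis
  proof (rule that[of \<sigma>])
    show "\<not> (\<sigma> i a \<in> F \<and> \<sigma> j a \<in> F)" if "i \<noteq> j" for i j a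
      using that \<sigma>(2)[of i j a] \<sigma>(2)[of j i a] by linarith
  qed (rule \<sigma>(1))
qed

section \<open>Invariant holomorphic functions ignore the infinite orbits\<close>

lemma inf_part_eq: "inf_part G = - fin_part G"
  by (auto simp: fin_part_iff inf_part_iff)

text \<open>The translates of \<open>z\<close> are supported in the finite union of the orbits that meet the support of \<open>z\<close>,
  and they take finitely many values there.\<close>

lemma finite_translates:
  assumes "z \<in> c0_on (fin_part G)" "finite {n. coord z n \<noteq> 0}"
  shows "finite ((\<lambda>\<sigma>. perm \<sigma> z) ` G)"
proof -
  define S where "S = {n. coord z n \<noteq> 0}"
  define X where "X = (\<Union>m\<in>S. orbit_of m)"
  define T where "T = {x. \<forall>n. (n \<in> X \<longrightarrow> x n \<in> insert 0 (coord z ` S)) \<and> (n \<notin> X \<longrightarrow> x n = (0 :: complex))}"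
  have "finite (orbit_of m)" if "m \<in> S" for m
    using assms(1) that by (auto simp: S_def c0_on_def fin_part_iff)
  then have "finite T"
    unfolding T_def X_def using assms(2)
    by (intro finite_set_of_finite_funs) (auto simp: S_def)
  moreover have "inj coord" by (simp add: inj_def coord_inject)
  ultimately have "finite (coord -` T)" by (rule finite_vimageI)
  moreover have "perm \<sigma> z \<in> coord -` T" if "\<sigma> \<in> G" for \<sigma>
  proof -
    have "n \<in> X" if "\<sigma> n \<in> S" for n
      using that orbit_of_perm[OF \<open>\<sigma> \<in> G\<close>, of n] self_mem_orbit_of[of n] by (auto simp: X_def)
    then show ?thesis
      using bij[OF that] by (auto simp: T_def coord_perm S_def)
  qed
  ultimately show ?thesis by (meson finite_subset image_subsetI)
qed

lemma inv_hol_perm: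
  assumes "f \<in> inv_hol G UNIV" "\<sigma> \<in> G" "norm z < 1"
  shows "f (perm \<sigma> z) = f z"
  using assms by (simp add: inv_hol_def unit_ball_def)

text \<open>The heart of the proof, combining disjoint translates of \<open>w\<close> with the pigeonhole principle for the
  translates of \<open>z\<close>. The identity theorem is needed because \<open>f\<close> may be unbounded on the ball, so that
  \<open>constant_along_disjoint_copies\<close> only reaches small multiples of \<open>w\<close>.\<close>

lemma inv_hol_eq_of_finite_support:
  assumes f: "f \<in> inv_hol G UNIV"
    and z: "z \<in> c0_on (fin_part G)" "finite {n. coord z n \<noteq> 0}" "norm z < 1"
    and w: "w \<in> c0_on (inf_part G)" "finite {n. coord w n \<noteq> 0}" "norm w < 1"
  shows "f (z + w) = f z"
proof -
  have hol: "holomorphic_ball UNIV f" using f by (simp add: inv_hol_def)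
  obtain \<sigma> :: "nat \<Rightarrow> nat \<Rightarrow> nat" where \<sigma>: "\<And>j. \<sigma> j \<in> G"
    "\<And>i j a. i \<noteq> j \<Longrightarrow> \<not> (coord w (\<sigma> i a) \<noteq> 0 \<and> coord w (\<sigma> j a) \<noteq> 0)"
  proof (rule disjoint_translates[OF w(2)])
    show "{n. coord w n \<noteq> 0} \<subseteq> inf_part G" using w(1) by (auto simp: c0_on_def)
  qed auto
  have "finite ((\<lambda>j. perm (\<sigma> j) z) ` UNIV)"
    by (rule finite_subset[OF _ finite_translates[OF z(1,2)]]) (use \<sigma>(1) in auto)
  then obtain j0 where inf: "infinite {j \<in> UNIV. perm (\<sigma> j) z = perm (\<sigma> j0) z}"
    using pigeonhole_infinite[of "UNIV :: nat set" "\<lambda>j. perm (\<sigma> j) z"] by auto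
  define J where "J = {j. perm (\<sigma> j) z = perm (\<sigma> j0) z}"
  define \<tau> where "\<tau> j = \<sigma> (enumerate J j)" for j
  have J: "infinite J" using inf by (simp add: J_def)
  have \<tau>: "\<tau> j \<in> G" "bij (\<tau> j)" "perm (\<tau> j) z = perm (\<sigma> j0) z" for j
    using \<sigma>(1) bij enumerate_in_set[OF J, of j] by (auto simp: \<tau>_def J_def)
  have disj: "coord (perm (\<tau> i) w) n = 0 \<or> coord (perm (\<tau> j) w) n = 0" if "i \<noteq> j" for i j n
    using \<sigma>(2)[of "enumerate J i" "enumerate J j" n] that strict_mono_enumerate[OF J] \<tau>(2)
    by (auto simp: coord_perm \<tau>_def strict_mono_eq)
  have zw: "coord z n = 0 \<or> coord w n = 0" for n
    using z(1) w(1) by (auto simp: c0_on_def inf_part_eq)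
  have line: "norm (z + cscale s w) < 1" if "norm s * norm w < 1" for s
  proof (rule norm_disjoint_sum_less_1[OF z(3)])
    show "norm (cscale s w) < 1" using that by (simp add: norm_cscale)
    show "coord z n = 0 \<or> coord (cscale s w) n = 0" for n using zw[of n] by (auto simp: coord_simps)
  qed
  have "\<exists>e>0. \<forall>s. norm s < e \<longrightarrow> f (z + cscale s w) = f (perm (\<sigma> j0) z)"
  proof (rule constant_along_disjoint_copies[OF hol _ _ disj])
    show "norm (perm (\<sigma> j0) z) < 1" "norm (perm (\<tau> j) w) < 1" for j
      using norm_perm_le[of "\<sigma> j0" z] norm_perm_le[OF \<tau>(2), of j w] bij[OF \<sigma>(1)] z(3) w(3)
      by (auto intro: order_le_less_trans)
    fix j and s :: complex assume "norm s \<le> 1"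
    then have "norm s * norm w < 1"
      using w(3) mult_right_mono[of "norm s" 1 "norm w"] by simp
    then show "f (perm (\<sigma> j0) z + cscale s (perm (\<tau> j) w)) = f (z + cscale s w)"
      using inv_hol_perm[OF f \<tau>(1)[of j] line] \<tau>(2,3)[of j] by (simp add: perm_add_cscale)
  qed
  then obtain e where e: "e > 0" "\<And>s. norm s < e \<Longrightarrow> f (z + cscale s w) = f z"
    using inv_hol_perm[OF f \<sigma>(1) z(3)] by auto
  \<comment> \<open>A disc that contains \<open>1\<close> in its interior and on which \<open>z + s w\<close> stays in the unit ball.\<close>
  define R where "R = 2 / (1 + norm w)"
  have R: "R > 1" "R * norm w < 1"
  proof -
    have "0 < 1 + norm w" using norm_ge_zero[of w] by linarith
    then show "R > 1" "R * norm w < 1"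
      using w(3) unfolding R_def by (simp_all add: less_divide_eq divide_less_eq)
  qed
  have "f (z + cscale 1 w) = f z"
  proof (rule analytic_continuation_open[of "ball 0 (min e 1)" "ball 0 R" "\<lambda>s. f (z + cscale s w)" "\<lambda>_. f z"])
    show "(\<lambda>s. f (z + cscale s w)) holomorphic_on ball 0 R"
    proof (rule holomorphic_ball_line[OF hol line])
      fix s :: complex assume "s \<in> ball 0 R"
      then show "norm s * norm w < 1"
        using mult_right_mono[of "norm s" R "norm w"] R(2) by simp
    qed
  qed (use e R in auto)
  moreover have "cscale 1 w = w" by (rule c0_eqI) (simp add: coord_simps)
  ultimately show ?thesis by simp
qed

lemma inv_hol_proj_fin_part:
  assumes f: "f \<in> inv_hol G UNIV" and z: "norm z < 1"
  shows "f (proj (fin_part G) z) = f z"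
proof -
  let ?P = "proj (fin_part G)" and ?Q = "proj (inf_part G)"
  let ?t = "\<lambda>N. proj {..<N} z"
  have norm_P: "norm (proj A x) < 1" if "norm x < 1" for A x
    using norm_proj_le[of A x] that by simp
  have cont: "isCont f x" if "norm x < 1" for x
    using holomorphic_ball_continuous[of f] f that
    by (auto simp: inv_hol_def unit_ball_def continuous_on_eq_continuous_at)
  have "f (?t N) = f (?P (?t N))" for N
  proof -
    have "?t N = ?P (?t N) + ?Q (?t N)"
      by (rule c0_eqI) (auto simp: coord_simps inf_part_eq)
    moreover have "f (?P (?t N) + ?Q (?t N)) = f (?P (?t N))"
      by (intro inv_hol_eq_of_finite_support f proj_in_c0_on norm_P z
          finite_subset[OF _ finite_lessThan[of N]]) (auto simp: coord_simps split: if_splits)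
    ultimately show ?thesis by simp
  qed
  moreover have "(\<lambda>N. f (?t N)) \<longlonglongrightarrow> f z"
    by (rule isCont_tendsto_compose[OF cont[OF z] proj_truncation_tendsto])
  moreover have "(\<lambda>N. f (?P (?t N))) \<longlonglongrightarrow> f (?P z)"
    by (intro isCont_tendsto_compose[OF cont[OF norm_P[OF z]]]
        bounded_linear.tendsto[OF bounded_linear_proj] proj_truncation_tendsto)
  ultimately show ?thesis
    using LIMSEQ_unique by fastforce
qed

lemma inv_hol_add_inf_part:
  assumes f: "f \<in> inv_hol G UNIV" and z': "z' \<in> c0_on (inf_part G)"
    and z: "norm z < 1" "norm (z' + z) < 1"
  shows "f (z' + z) = f z"
proof -
  have "proj (fin_part G) (z' + z) = proj (fin_part G) z"
    using z' by (intro c0_eqI) (auto simp: coord_simps c0_on_def inf_part_eq)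
  then show ?thesis
    using inv_hol_proj_fin_part[OF f z(1)] inv_hol_proj_fin_part[OF f z(2)] by simp
qed

section \<open>The pullback isomorphism\<close>

lemma proj_perm:
  assumes "\<sigma> \<in> G"
  shows "proj (fin_part G) (perm \<sigma> z) = perm \<sigma> (proj (fin_part G) z)"
  using assms by (intro c0_eqI) (simp add: coord_perm[OF bij] coord_simps perm_fin_part_iff)

lemma perm_in_unit_ball:
  assumes "\<sigma> \<in> G" "z \<in> unit_ball UNIV"
  shows "perm \<sigma> z \<in> unit_ball UNIV"
  using norm_perm_le[OF bij[OF assms(1)], of z] assms(2) by (simp add: unit_ball_def)

lemma pullback_in_inv_hol:
  assumes f: "f \<in> inv_hol G (c0_on (fin_part G))"
  shows "pullback (fin_part G) f \<in> inv_hol G UNIV"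
proof -
  let ?P = "proj (fin_part G)" and ?V = "c0_on (fin_part G)"
  have eq: "pullback (fin_part G) f z = f (?P z)" if "z \<in> unit_ball UNIV" for z
    using that by (simp add: pullback_def)
  have "holomorphic_ball UNIV (pullback (fin_part G) f)"
    unfolding holomorphic_ball_def
  proof
    fix z assume z: "z \<in> unit_ball UNIV"
    obtain D where D: "(f has_derivative D) (at (?P z) within unit_ball ?V)"
      and hom: "\<And>a h. h \<in> ?V \<Longrightarrow> D (cscale a h) = a * D h"
      using f proj_in_unit_ball[OF z] unfolding inv_hol_def holomorphic_ball_def by blast
    have "((f \<circ> ?P) has_derivative (D \<circ> ?P)) (at z within unit_ball UNIV)"
      by (intro diff_chain_within bounded_linear_imp_has_derivative bounded_linear_proj
          has_derivative_subset[OF D]) (auto intro: proj_in_unit_ball)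
    then have "(pullback (fin_part G) f has_derivative (D \<circ> ?P)) (at z within unit_ball UNIV)"
      by (rule has_derivative_transform[OF z, rotated]) (simp add: eq)
    then show "\<exists>D. (pullback (fin_part G) f has_derivative D) (at z within unit_ball UNIV) \<and>
        (\<forall>a. \<forall>h\<in>UNIV. D (cscale a h) = a * D h)"
      by (intro exI[of _ "D \<circ> ?P"]) (simp add: proj_cscale hom proj_in_c0_on)
  qed
  then show ?thesis
    using f perm_in_unit_ball proj_in_unit_ball
    by (auto simp: inv_hol_def eq proj_perm) (simp add: pullback_def)
qed

lemma restrict_in_inv_hol:
  assumes g: "g \<in> inv_hol G UNIV"
  shows "restrict g (unit_ball (c0_on (fin_part G))) \<in> inv_hol G (c0_on (fin_part G))"
proof -
  let ?V = "c0_on (fin_part G)"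
  have sub: "unit_ball ?V \<subseteq> unit_ball UNIV" by (auto simp: unit_ball_def)
  have "holomorphic_ball ?V (restrict g (unit_ball ?V))"
    unfolding holomorphic_ball_def
  proof
    fix z assume z: "z \<in> unit_ball ?V"
    then obtain D where D: "(g has_derivative D) (at z within unit_ball UNIV)"
      and hom: "\<And>a h. D (cscale a h) = a * D h"
      using g sub unfolding inv_hol_def holomorphic_ball_def by blast
    have "(restrict g (unit_ball ?V) has_derivative D) (at z within unit_ball ?V)"
      by (rule has_derivative_transform[OF z _ has_derivative_subset[OF D sub]]) simp
    with hom show "\<exists>D. (restrict g (unit_ball ?V) has_derivative D) (at z within unit_ball ?V) \<and>
        (\<forall>a. \<forall>h\<in>?V. D (cscale a h) = a * D h)" by blast
  qed
  moreover have "perm \<sigma> z \<in> unit_ball ?V" if "\<sigma> \<in> G" "z \<in> unit_ball ?V" for \<sigma> z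
  proof -
    have "perm \<sigma> z \<in> c0_on (fin_part G)"
      using that by (auto simp: c0_on_def unit_ball_def coord_perm[OF bij] perm_fin_part_iff)
    then show ?thesis
      using perm_in_unit_ball[OF that(1)] that(2) sub by (auto simp: unit_ball_def)
  qed
  ultimately show ?thesis
    using g sub by (auto simp: inv_hol_def)
qed

text \<open>The inverse is restriction; that it is a right inverse is the independence of the coordinates in
  infinite orbits.\<close>

lemma bij_betw_pullback:
  "bij_betw (pullback (fin_part G)) (inv_hol G (c0_on (fin_part G))) (inv_hol G UNIV)"
proof (rule bij_betw_byWitness[where f' = "\<lambda>g. restrict g (unit_ball (c0_on (fin_part G)))"])
  let ?V = "c0_on (fin_part G)"
  have sub: "unit_ball ?V \<subseteq> unit_ball UNIV" by (auto simp: unit_ball_def)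
  show "\<forall>f\<in>inv_hol G ?V. restrict (pullback (fin_part G) f) (unit_ball ?V) = f"
  proof (intro ballI extensionalityI)
    fix f z assume "f \<in> inv_hol G ?V" "z \<in> unit_ball ?V"
    then show "restrict (pullback (fin_part G) f) (unit_ball ?V) z = f z"
      using sub by (auto simp: pullback_def proj_id unit_ball_def)
  qed (auto simp: inv_hol_def)
  show "\<forall>g\<in>inv_hol G UNIV. pullback (fin_part G) (restrict g (unit_ball ?V)) = g"
  proof (intro ballI extensionalityI)
    fix g z assume "g \<in> inv_hol G UNIV" "z \<in> unit_ball UNIV"
    then show "pullback (fin_part G) (restrict g (unit_ball ?V)) z = g z"
      using proj_in_unit_ball[of z] inv_hol_proj_fin_part[of g z]
      by (simp add: pullback_def) (simp add: unit_ball_def)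
  qed (auto simp: inv_hol_def pullback_def)
qed (auto intro: pullback_in_inv_hol restrict_in_inv_hol)

end

lemma pullback_algebra_hom:
  fixes A G
  defines "P \<equiv> inv_hol_algebra G (c0_on A)" and "Q \<equiv> inv_hol_algebra G UNIV"
  shows "pullback A (f \<otimes>\<^bsub>P\<^esub> g) = pullback A f \<otimes>\<^bsub>Q\<^esub> pullback A g"
    "pullback A (f \<oplus>\<^bsub>P\<^esub> g) = pullback A f \<oplus>\<^bsub>Q\<^esub> pullback A g"
    "pullback A \<one>\<^bsub>P\<^esub> = \<one>\<^bsub>Q\<^esub>"
    "pullback A (a \<odot>\<^bsub>P\<^esub> f) = a \<odot>\<^bsub>Q\<^esub> pullback A f"
  using proj_in_unit_ball[of _ A]
  by (auto simp: P_def Q_def inv_hol_algebra_def pullback_def fun_eq_iff restrict_def)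

theorem theorem7p1:
  fixes G :: "(nat \<Rightarrow> nat) set"
  assumes "subgroup G sym_N"
  shows "(\<forall>f\<in>inv_hol G UNIV. \<forall>z'\<in>unit_ball (c0_on (inf_part G)). \<forall>z\<in>unit_ball UNIV.
            z' + z \<in> unit_ball UNIV \<longrightarrow> f (z' + z) = f z) \<and>
         pullback (fin_part G) \<in>
           algebra_iso (inv_hol_algebra G (c0_on (fin_part G))) (inv_hol_algebra G UNIV)"
proof -
  interpret permutation_subgroup G
    by (rule permutation_subgroup.intro[OF assms])
  have carrier: "carrier (inv_hol_algebra G V) = inv_hol G V" for V
    by (simp add: inv_hol_algebra_def)
  have "pullback (fin_part G) \<in>
      ring_hom (inv_hol_algebra G (c0_on (fin_part G))) (inv_hol_algebra G UNIV)"
    by (rule ring_hom_memI) (auto simp: carrier pullback_algebra_hom intro: pullback_in_inv_hol)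
  then have "pullback (fin_part G) \<in>
      algebra_iso (inv_hol_algebra G (c0_on (fin_part G))) (inv_hol_algebra G UNIV)"
    by (simp add: algebra_iso_def ring_iso_def carrier bij_betw_pullback pullback_algebra_hom)
  then show ?thesis
    using inv_hol_add_inf_part by (auto simp: unit_ball_def)
qed

end
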